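(* Let $(x_e,u_e)$ be the constrained optimal steady state, i.e. the unique minimizer of $\ell(x,u)$ subject to $(x,u)\in S$ and $Ax+Bu=x$. Assume that each unobservable eigenvalue $\gamma$ of the pair $(A,C)$ satisfies $|\gamma|\neq 1$, and that the KKT conditions are verified at $(x_e,u_e)$. Then the constrained optimal control problem $(CLQ)_N$ is strictly pre-dissipative at $(x_e,u_e)$. If, in addition, the pair $(A,C)$ is detectable, then the problem is strictly dissipative at $(x_e,u_e)$.
   Context: Setting. Let $A\in\mathbb{R}^{n\times n}$, $B\in\mathbb{R}^{n\times m}$, $Q\in\mathbb{R}^{n\times n}$ positive semi-definite and $R\in\mathbb{R}^{m\times m}$ positive definite (symmetric), with $Q=C^TC$ for some $C\in\mathbb{R}^{n\times n}$ and $R=K^TK$ for some invertible $K\in\mathbb{R}^{m\times m}$; let $z\in\mathbb{R}^n$, $v\in\mathbb{R}^m$, $c\in\mathbb{R}$. The stage cost is $\ell(x,u)=x^TQx+u^TRu+2z^Tx+2v^Tu+c$. The constraint set is $S=\{(x,u)\in\mathbb{R}^{n}\times\mathbb{R}^m : g(x,u)\le 0\}$ for some convex function $g:\mathbb{R}^n\times\mathbb{R}^m\to\mathbb{R}$, and it is assumed that $\partial S=\{(x,u): g(x,u)=0\}$. Let $X=\{x\in\mathbb{R}^n : \exists u\in\mathbb{R}^m,\ (x,u)\in S\}$. The constrained optimal control problem $(CLQ)_N$, for $N\in\mathbb{N}$ and $x_0\in\mathbb{R}^n$, is to minimize $\sum_{i=0}^{N-1}\ell(x(i),u(i))$ over controls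 $u$ subject to $x(i+1)=Ax(i)+Bu(i)$ for $i=0,\dots,N-1$, $x(0)=x_0$, $(x(i),u(i))\in S$ for $i=0,\dots,N-1$, and $x(N)\in X$. A steady state is a pair $(x_e,u_e)\in S$ with $x_e=Ax_e+Bu_e$. Unobservable eigenvalue: $\gamma\in\mathbb{C}$ is an unobservable eigenvalue of $(A,C)$ if $\gamma$ is an eigenvalue of $A$ having a nonzero eigenvector $x_0\in\mathbb{C}^n$ with $Cx_0=0$. Detectability of $(A,C)$ is the usual discrete-time notion (equivalently, every unobservable eigenvalue satisfies $|\gamma|<1$). KKT conditions at $(x_e,u_e)$: there exist $\lambda\in\mathbb{R}^n$, $\mu\in\mathbb{R}$ and a subgradient $\nu\in\mathbb{R}^{1\times(n+m)}$ of $g$ at $(x_e,u_e)$ such that $$\begin{bmatrix}2C^TCx_e+2z\\ 2K^TKu_e+2v\end{bmatrix}+\begin{bmatrix}A^T-I\\ B^T\end{bmatrix}\lambda+\mu\,\nu^T=0,\quad Ax_e+Bu_e=x_e,\quad \mu\ge 0,\quad g(x_e,u_e)\mu=0.$$ Dissipativity. Let $\mathcal{K}$ be the set of continuous, strictly increasing functions $f:[0,\infty)\to[0,\infty)$ with $f(0)=0$. The problem is strictly pre-dissipative at a steady state $(x_e,u_e)\in S$ if there exist a storage function $V:\mathbb{R}^n\to\mathbb{R}$ that is bounded on bounded subsets of $\mathbb{R}^n$, a norm $\|\cdot\|_{\mathrm{diss}}$ on $\mathbb{R}^n\times\mathbb{R}^m$ and $\alpha\in\mathcal{K}$ such that for all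 $(x,u)\in S$ $$V(Ax+Bu)\le V(x)+\ell(x,u)-\ell(x_e,u_e)-\alpha(\|(x-x_e,u-u_e)\|_{\mathrm{diss}}).$$ It is strictly dissipative at $(x_e,u_e)$ if it is strictly pre-dissipative there with a storage function $V$ that is, in addition, bounded from below on $X$. *)

theory Defs
  imports "HOL-Analysis.Analysis"
begin

text \<open>The data of the family of problems: minimise the sum of
  \<open>stage_cost P (x i, u i)\<close> over \<open>i < N\<close> subject to \<open>x (i + 1) = dynamics P (x i, u i)\<close>, \<open>x 0 = x0\<close>,
  \<open>(x i, u i) \<in> constraints P\<close> for \<open>i < N\<close>, and \<open>x N \<in> state_constraints P\<close>.  The horizon \<open>N\<close> and
  the initial value \<open>x0\<close> are not part of the record: steady states and dissipativity do not
  depend on them.\<close>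

record ('x, 'u) ocp =
  dynamics :: "'x \<times> 'u \<Rightarrow> 'x"
  stage_cost :: "'x \<times> 'u \<Rightarrow> real"
  constraints :: "('x \<times> 'u) set"

definition state_constraints :: "('x, 'u) ocp \<Rightarrow> 'x set" where
  "state_constraints P = {x. \<exists>u. (x, u) \<in> constraints P}"

definition steady_state :: "('x, 'u) ocp \<Rightarrow> 'x \<times> 'u \<Rightarrow> bool" where
  "steady_state P e \<longleftrightarrow> e \<in> constraints P \<and> dynamics P e = fst e"

definition optimal_steady_state :: "('x, 'u) ocp \<Rightarrow> 'x \<times> 'u \<Rightarrow> bool" where
  "optimal_steady_state P e \<longleftrightarrow>
     is_arg_min (stage_cost P) (steady_state P) e \<and>
     (\<forall>e'. is_arg_min (stage_cost P) (steady_state P) e' \<longrightarrow> e' = e)"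

text \<open>Comparison functions live on \<open>[0,\<infinity>)\<close>; values at negative arguments are irrelevant.\<close>

definition class_K :: "(real \<Rightarrow> real) set" where
  "class_K = {\<alpha>. (\<forall>r\<ge>0. \<alpha> r \<ge> 0) \<and> continuous_on {0..} \<alpha> \<and> strict_mono_on {0..} \<alpha> \<and> \<alpha> 0 = 0}"

definition is_norm :: "('a::real_vector \<Rightarrow> real) \<Rightarrow> bool" where
  "is_norm nrm \<longleftrightarrow>
     (\<forall>w. nrm w \<ge> 0) \<and>
     (\<forall>w. nrm w = 0 \<longleftrightarrow> w = 0) \<and>
     (\<forall>a w. nrm (a *\<^sub>R w) = \<bar>a\<bar> * nrm w) \<and>
     (\<forall>w w'. nrm (w + w') \<le> nrm w + nrm w')"

definition strict_storage ::
    "('x::real_normed_vector, 'u::real_normed_vector) ocp \<Rightarrow> 'x \<times> 'u \<Rightarrow> ('x \<Rightarrow> real) \<Rightarrow> bool" where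
  "strict_storage P e V \<longleftrightarrow>
     (\<forall>D. bounded D \<longrightarrow> bounded (V ` D)) \<and>
     (\<exists>nrm \<alpha>. is_norm nrm \<and> \<alpha> \<in> class_K \<and>
        (\<forall>w\<in>constraints P.
           V (dynamics P w) \<le> V (fst w) + stage_cost P w - stage_cost P e - \<alpha> (nrm (w - e))))"

definition strictly_pre_dissipative ::
    "('x::real_normed_vector, 'u::real_normed_vector) ocp \<Rightarrow> 'x \<times> 'u \<Rightarrow> bool" where
  "strictly_pre_dissipative P e \<longleftrightarrow> steady_state P e \<and> (\<exists>V. strict_storage P e V)"

definition strictly_dissipative ::
    "('x::real_normed_vector, 'u::real_normed_vector) ocp \<Rightarrow> 'x \<times> 'u \<Rightarrow> bool" where
  "strictly_dissipative P e \<longleftrightarrow>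
     steady_state P e \<and> (\<exists>V. strict_storage P e V \<and> bdd_below (V ` state_constraints P))"

definition pos_semidefinite :: "real^'n^'n \<Rightarrow> bool" where
  "pos_semidefinite M \<longleftrightarrow> transpose M = M \<and> (\<forall>x. x \<bullet> (M *v x) \<ge> 0)"

definition pos_definite :: "real^'n^'n \<Rightarrow> bool" where
  "pos_definite M \<longleftrightarrow> transpose M = M \<and> (\<forall>x. x \<noteq> 0 \<longrightarrow> x \<bullet> (M *v x) > 0)"

abbreviation complex_matrix :: "real^'n^'m \<Rightarrow> complex^'n^'m" where
  "complex_matrix \<equiv> map_matrix complex_of_real"

definition eigenvector :: "real^'n^'n \<Rightarrow> complex \<Rightarrow> complex^'n \<Rightarrow> bool" where
  "eigenvector A \<gamma> x \<longleftrightarrow> x \<noteq> 0 \<and> complex_matrix A *v x = \<gamma> *s x"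

definition unobservable_eigenvalue :: "real^'n^'n \<Rightarrow> real^'n^'p \<Rightarrow> complex \<Rightarrow> bool" where
  "unobservable_eigenvalue A C \<gamma> \<longleftrightarrow>
     (\<exists>x. eigenvector A \<gamma> x \<and> complex_matrix C *v x = 0)"

definition schur_stable :: "real^'n^'n \<Rightarrow> bool" where
  "schur_stable A \<longleftrightarrow> (\<forall>\<gamma> x. eigenvector A \<gamma> x \<longrightarrow> cmod \<gamma> < 1)"

text \<open>Detectability: some output injection (observer gain) \<open>L\<close> makes the observer error
  dynamics \<open>A + L C\<close> asymptotically stable.\<close>

definition detectable :: "real^'n^'n \<Rightarrow> real^'n^'p \<Rightarrow> bool" where
  "detectable A C \<longleftrightarrow> (\<exists>L :: real^'p^'n. schur_stable (A + L ** C))"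

definition lq_cost ::
    "real^'n^'n \<Rightarrow> real^'m^'m \<Rightarrow> real^'n \<Rightarrow> real^'m \<Rightarrow> real \<Rightarrow> (real^'n) \<times> (real^'m) \<Rightarrow> real" where
  "lq_cost Q R z v c = (\<lambda>(x, u). x \<bullet> (Q *v x) + u \<bullet> (R *v u) + 2 * (z \<bullet> x) + 2 * (v \<bullet> u) + c)"

definition CLQ ::
    "real^'n^'n \<Rightarrow> real^'m^'n \<Rightarrow> real^'n^'n \<Rightarrow> real^'m^'m \<Rightarrow> real^'n \<Rightarrow> real^'m \<Rightarrow> real \<Rightarrow>
     ((real^'n) \<times> (real^'m) \<Rightarrow> real) \<Rightarrow> (real^'n, real^'m) ocp" where
  "CLQ A B Q R z v c g =
     \<lparr> dynamics = (\<lambda>(x, u). A *v x + B *v u),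
       stage_cost = lq_cost Q R z v c,
       constraints = {w. g w \<le> 0} \<rparr>"

definition subgradient :: "('a::real_inner \<Rightarrow> real) \<Rightarrow> 'a \<Rightarrow> 'a \<Rightarrow> bool" where
  "subgradient g w \<nu> \<longleftrightarrow> (\<forall>w'. g w' \<ge> g w + \<nu> \<bullet> (w' - w))"

definition KKT ::
    "real^'n^'n \<Rightarrow> real^'m^'n \<Rightarrow> real^'n^'n \<Rightarrow> real^'m^'m \<Rightarrow> real^'n \<Rightarrow> real^'m \<Rightarrow>
     ((real^'n) \<times> (real^'m) \<Rightarrow> real) \<Rightarrow> (real^'n) \<times> (real^'m) \<Rightarrow> bool" where
  "KKT A B C K z v g = (\<lambda>(x\<^sub>e, u\<^sub>e).
     \<exists>(lam :: real^'n) (\<mu> :: real) (\<nu> :: (real^'n) \<times> (real^'m)).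
       subgradient g (x\<^sub>e, u\<^sub>e) \<nu> \<and>
       (2 *\<^sub>R ((transpose C ** C) *v x\<^sub>e) + 2 *\<^sub>R z, 2 *\<^sub>R ((transpose K ** K) *v u\<^sub>e) + 2 *\<^sub>R v)
         + ((transpose A - mat 1) *v lam, transpose B *v lam) + \<mu> *\<^sub>R \<nu> = 0 \<and>
       A *v x\<^sub>e + B *v u\<^sub>e = x\<^sub>e \<and>
       \<mu> \<ge> 0 \<and>
       g (x\<^sub>e, u\<^sub>e) * \<mu> = 0)"

end

theory Submission
  imports Defs "HOL-Computational_Algebra.Fundamental_Theorem_Algebra"
begin

text \<open>By the KKT conditions the linear storage function \<open>x \<mapsto> - lam \<bullet> x\<close> (\<open>lam\<close> the multiplier of
  the steady-state equation) bounds the rotated cost on the constraint set below by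
  \<open>\<bar>C (x - x\<^sub>e)\<bar>\<^sup>2 + \<bar>K (u - u\<^sub>e)\<bar>\<^sup>2\<close>. It remains to add a small multiple of a quadratic form \<open>P\<close>
  with \<open>t C\<^sup>T C + P - A\<^sup>T P A\<close> positive definite, \<open>t \<ge> 0\<close>. If no \<open>P\<close> in a given convex cone works, then
  separating the cone of these matrices from the positive definite ones yields a positive
  semidefinite \<open>W \<noteq> 0\<close> with \<open>C W = 0\<close> and \<open>\<langle>W, P - A\<^sup>T P A\<rangle> \<le> 0\<close> for all \<open>P\<close> in the cone.

  For the cone of all matrices this means \<open>W = A W A\<^sup>T\<close>. Taking \<open>x\<close> with \<open>W x \<noteq> 0\<close> and
  \<open>W A\<^sup>T x = \<gamma> W x\<close>, comparison of \<open>x\<^sup>* W x\<close> with \<open>x\<^sup>* A W A\<^sup>T x\<close> shows \<open>\<bar>\<gamma>\<bar> = 1\<close>, and \<open>W x\<close> is an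
  unobservable eigenvector for \<open>\<gamma>\<^sup>-\<^sup>1\<close>. For the cone of positive semidefinite forms it means
  \<open>W \<le> A W A\<^sup>T = F W F\<^sup>T\<close> with \<open>F = A + L C\<close>, and the same comparison gives an eigenvalue of \<open>F\<close> of
  modulus at least 1, so \<open>F\<close> is not Schur stable.\<close>

subsection \<open>A theorem of the alternative for the Stein inequality\<close>

text \<open>Rank-one matrices serve as test matrices: the entrywise inner product of
  \<open>W\<close> with \<open>outer x y\<close> is the bilinear form of \<open>W\<close> at
  \<open>x\<close> and \<open>y\<close>, so properties of a linear functional become properties of a
  matrix.\<close>

definition outer :: "real^'n \<Rightarrow> real^'m \<Rightarrow> real^'m^'n" where
  "outer x y = (\<chi> i j. x $ i * y $ j)"

lemma outer_mult_vec: "outer x y *v w = (y \<bullet> w) *\<^sub>R x"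
  by (simp add: outer_def matrix_vector_mult_def vec_eq_iff inner_vec_def sum_distrib_left mult_ac)

lemma inner_outer: "W \<bullet> outer x y = x \<bullet> (W *v y)"
  by (simp add: outer_def inner_vec_def matrix_vector_mult_def sum_distrib_left mult_ac)

section \<open>Congruence and semidefinite forms\<close>

lemma inner_matrix_vector_transpose: "(A *v x) \<bullet> y = x \<bullet> (transpose A *v y)" for A :: "real^'n^'m"
  by (metis dot_lmul_matrix inner_commute transpose_matrix_vector transpose_transpose)

lemma outer_congruence: "transpose A ** outer x y ** A = outer (transpose A *v x) (transpose A *v y)"
  for A :: "real^'n^'n"
proof -
  have "(transpose A ** outer x y ** A) *v w = (y \<bullet> (A *v w)) *\<^sub>R (transpose A *v x)" for w
    by (simp add: outer_mult_vec matrix_vector_mult_scaleR del: transpose_matrix_vector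
        flip: matrix_vector_mul_assoc)
  moreover have "y \<bullet> (A *v w) = (transpose A *v y) \<bullet> w" for w
    by (metis inner_commute inner_matrix_vector_transpose)
  ultimately show ?thesis
    by (simp add: matrix_eq outer_mult_vec del: transpose_matrix_vector)
qed

lemma transpose_mult_form: "x \<bullet> ((transpose C ** C) *v x) = (norm (C *v x))\<^sup>2" for C :: "real^'n^'p"
  by (metis inner_matrix_vector_transpose matrix_vector_mul_assoc power2_norm_eq_inner)

lemma congruence_form: "x \<bullet> ((transpose A ** P ** A) *v x) = (A *v x) \<bullet> (P *v (A *v x))"
  for A :: "real^'n^'m"
  by (metis inner_matrix_vector_transpose matrix_vector_mul_assoc)

text \<open>The form is perturbed along \<open>W *v x\<close>: its first-order change is
  \<open>2 * t\<close> times the squared norm of \<open>W *v x\<close>, so a small negative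
  \<open>t\<close> would make it negative unless that vector vanishes.\<close>

lemma psd_form_zero_imp_kernel:
  fixes W :: "real^'n^'n"
  assumes sym: "transpose W = W" and psd: "\<And>x. 0 \<le> x \<bullet> (W *v x)" and zero: "x \<bullet> (W *v x) = 0"
  shows "W *v x = 0"
proof -
  define y where "y = W *v x"
  have expand: "(x + t *\<^sub>R y) \<bullet> (W *v (x + t *\<^sub>R y)) = 2 * t * (y \<bullet> y) + t\<^sup>2 * (y \<bullet> (W *v y))" for t
  proof -
    have "x \<bullet> (W *v y) = y \<bullet> y"
      by (metis inner_matrix_vector_transpose sym y_def)
    then show ?thesis
      using zero by (simp add: matrix_vector_right_distrib inner_simps matrix_vector_mult_scaleR
          power2_eq_square algebra_simps flip: y_def)
  qed
  \<comment> \<open>Adding 1 keeps \<open>m\<close> positive even if \<open>y\<close> has zero form;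
    at \<open>t = - Y / m\<close> the perturbed form equals
    \<open>- Y^2 (m + 1) / m^2\<close>.\<close>
  define m where "m = y \<bullet> (W *v y) + 1"
  define Y where "Y = y \<bullet> y"
  have m: "m > 0" using psd[of y] by (simp add: m_def)
  have "0 \<le> 2 * (- Y / m) * Y + (- Y / m)\<^sup>2 * (m - 1)"
    using psd[of "x + (- Y / m) *\<^sub>R y"] unfolding expand by (simp add: m_def Y_def)
  then have "0 \<le> m\<^sup>2 * (2 * (- Y / m) * Y + (- Y / m)\<^sup>2 * (m - 1))"
    by simp
  also have "\<dots> = - (Y\<^sup>2 * (m + 1))"
    using m by (simp add: power2_eq_square field_simps)
  finally have "Y\<^sup>2 * (m + 1) \<le> 0" by simp
  with m have "Y = 0" by (simp add: mult_le_0_iff)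
  then show ?thesis by (simp add: Y_def y_def)
qed

lemma matrix_stein_alternative:
  fixes A :: "real^'n^'n" and C :: "real^'n^'p"
  assumes cone: "convex_cone \<P>"
  obtains (storage) t P where "0 \<le> t" "P \<in> \<P>"
      "\<And>x. x \<noteq> 0 \<Longrightarrow> 0 < t * (norm (C *v x))\<^sup>2 + x \<bullet> (P *v x) - (A *v x) \<bullet> (P *v (A *v x))"
  | (multiplier) W where "W \<noteq> 0" "transpose W = W" "\<And>x. 0 \<le> x \<bullet> (W *v x)" "C ** W = 0"
      "\<And>P. P \<in> \<P> \<Longrightarrow> W \<bullet> P \<le> W \<bullet> (transpose A ** P ** A)"
proof -
  define S where "S P = P - transpose A ** P ** A" for P
  \<comment> \<open>Membership in \<open>T\<close> does not ask for symmetry, so \<open>T\<close> is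
    stable under adding skew-symmetric matrices; this is what makes the separating \<open>W\<close>
    symmetric.\<close>
  define T where "T = {X :: real^'n^'n. \<forall>x. x \<noteq> 0 \<longrightarrow> 0 < x \<bullet> (X *v x)}"
  define D where "D = (\<lambda>(t, P). t *\<^sub>R (transpose C ** C) + S P) ` ({0..} \<times> \<P>)"
  have S_lin: "linear S"
    unfolding S_def
    by (rule linearI)
      (simp_all add: matrix_eq matrix_vector_mult_add_rdistrib matrix_vector_mult_diff_rdistrib
        matrix_vector_right_distrib matrix_vector_mult_scaleR scaleR_right_diff_distrib
        flip: matrix_vector_mul_assoc scaleR_matrix_vector_assoc)
  have D_I: "t *\<^sub>R (transpose C ** C) + S P \<in> D" if "0 \<le> t" "P \<in> \<P>" for t P
    using that by (auto simp: D_def)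
  have D_scale: "a *\<^sub>R d \<in> D" if "d \<in> D" "0 \<le> a" for a d
  proof -
    from that(1) obtain t P where tP: "0 \<le> t" "P \<in> \<P>" "d = t *\<^sub>R (transpose C ** C) + S P"
      by (auto simp: D_def)
    then have "a *\<^sub>R d = (a * t) *\<^sub>R (transpose C ** C) + S (a *\<^sub>R P)"
      by (simp add: scaleR_right_distrib linear_scale[OF S_lin])
    moreover have "a *\<^sub>R P \<in> \<P>"
      using cone tP(2) that(2) by (simp add: convex_cone_scaleR)
    ultimately show ?thesis using D_I tP(1) that(2) by simp
  qed
  have D_add: "d + d' \<in> D" if dd: "d \<in> D" "d' \<in> D" for d d'
  proof -
    from dd obtain t P t' P' where "0 \<le> t" "P \<in> \<P>" "d = t *\<^sub>R (transpose C ** C) + S P"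
      "0 \<le> t'" "P' \<in> \<P>" "d' = t' *\<^sub>R (transpose C ** C) + S P'"
      by (auto simp: D_def)
    moreover from this have "d + d' = (t + t') *\<^sub>R (transpose C ** C) + S (P + P')"
      by (simp add: scaleR_left_distrib linear_add[OF S_lin])
    moreover have "P + P' \<in> \<P>" using cone calculation by (simp add: convex_cone_add)
    ultimately show ?thesis using D_I by simp
  qed
  have zero: "0 \<in> \<P>" using cone by (simp add: convex_cone_contains_0)
  have "0 \<in> D" using zero linear_0[OF S_lin] by (force simp: D_def)
  have "convex D"
    by (rule convexI) (simp add: D_add D_scale)
  have "convex T"
  proof (rule convexI)
    fix X Y :: "real^'n^'n" and a b :: real
    assume XY: "X \<in> T" "Y \<in> T" and ab: "0 \<le> a" "0 \<le> b" "a + b = 1"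
    have "0 < a * (x \<bullet> (X *v x)) + b * (x \<bullet> (Y *v x))" if "x \<noteq> 0" for x
      using convex_bound_lt[of "- (x \<bullet> (X *v x))" 0 "- (x \<bullet> (Y *v x))", OF _ _ ab] XY that
      by (simp add: T_def)
    then show "a *\<^sub>R X + b *\<^sub>R Y \<in> T"
      by (simp add: T_def matrix_vector_mult_add_rdistrib inner_add_right flip: scaleR_matrix_vector_assoc)
  qed
  have I_T: "mat 1 \<in> T" by (simp add: T_def)
  show ?thesis
  proof (cases "T \<inter> D = {}")
    case False
    then obtain t P where *: "0 \<le> t" "P \<in> \<P>" "t *\<^sub>R (transpose C ** C) + S P \<in> T"
      by (auto simp: D_def)
    have "0 < t * (norm (C *v x))\<^sup>2 + x \<bullet> (P *v x) - (A *v x) \<bullet> (P *v (A *v x))" if "x \<noteq> 0" for x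
    proof -
      have "0 < x \<bullet> ((t *\<^sub>R (transpose C ** C) + S P) *v x)"
        using *(3) that by (simp add: T_def)
      then show ?thesis
        by (simp add: S_def matrix_vector_mult_add_rdistrib matrix_vector_mult_diff_rdistrib inner_add_right
            inner_diff_right transpose_mult_form congruence_form flip: scaleR_matrix_vector_assoc)
    qed
    with * storage show ?thesis by blast
  next
    case True
    then obtain W b where W: "W \<noteq> 0" "\<And>d. d \<in> D \<Longrightarrow> W \<bullet> d \<le> b" "\<And>X. X \<in> T \<Longrightarrow> b \<le> W \<bullet> X"
      using separating_hyperplane_sets[of D T] \<open>convex D\<close> \<open>convex T\<close> \<open>0 \<in> D\<close> I_T
      by (metis Int_commute empty_iff)
    have "0 \<le> b" using W(2)[OF \<open>0 \<in> D\<close>] by simp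
    \<comment> \<open>\<open>D\<close> is closed under nonnegative scaling, so a positive value on
      \<open>D\<close> could be scaled up to \<open>b + 1\<close>.\<close>
    have W_D: "W \<bullet> d \<le> 0" if "d \<in> D" for d
    proof (rule ccontr)
      assume neg: "\<not> W \<bullet> d \<le> 0"
      have "W \<bullet> (((b + 1) / (W \<bullet> d)) *\<^sub>R d) \<le> b"
        using W(2) D_scale[OF that] neg \<open>0 \<le> b\<close> by (simp del: inner_scaleR_right)
      with neg show False by simp
    qed
    have W_psd: "0 \<le> W \<bullet> X" if "\<And>x. 0 \<le> x \<bullet> (X *v x)" for X
    proof (rule ccontr)
      assume neg: "\<not> 0 \<le> W \<bullet> X"
      \<comment> \<open>Shifting \<open>X\<close> by \<open>\<epsilon>\<close> times the identity
        moves it into \<open>T\<close>; this \<open>\<epsilon>\<close> is so small that the shift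
        makes up at most half of the deficit \<open>- (W \<bullet> X)\<close>.\<close>
      define \<epsilon> where "\<epsilon> = - (W \<bullet> X) / (2 * (\<bar>W \<bullet> mat 1\<bar> + 1))"
      have "\<epsilon> > 0" using neg by (simp add: \<epsilon>_def divide_neg_pos)
      have "X + \<epsilon> *\<^sub>R mat 1 \<in> T"
        using that \<open>\<epsilon> > 0\<close>
        by (auto simp: T_def matrix_vector_mult_add_rdistrib inner_simps add_nonneg_pos
            simp flip: scaleR_matrix_vector_assoc)
      then have "0 \<le> W \<bullet> X + \<epsilon> * (W \<bullet> mat 1)"
        using W(3)[of "X + \<epsilon> *\<^sub>R mat 1"] \<open>0 \<le> b\<close> by (simp add: inner_simps)
      also have "\<epsilon> * (W \<bullet> mat 1) \<le> \<epsilon> * (\<bar>W \<bullet> mat 1\<bar> + 1)"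
        using \<open>\<epsilon> > 0\<close> by (intro mult_left_mono) auto
      also have "\<dots> = - (W \<bullet> X) / 2" by (simp add: \<epsilon>_def field_simps)
      finally show False using neg by simp
    qed
    \<comment> \<open>The difference of the two rank-one matrices is skew-symmetric. It and its
      negative have zero form, so \<open>W\<close> is orthogonal to it.\<close>
    have sym': "x \<bullet> (W *v y) = y \<bullet> (W *v x)" for x y
      using W_psd[of "outer x y - outer y x"] W_psd[of "outer y x - outer x y"]
      by (simp add: inner_diff_right inner_outer matrix_vector_mult_diff_rdistrib outer_mult_vec
          inner_commute mult.commute)
    have "y \<bullet> (transpose W *v x) = y \<bullet> (W *v x)" for x y
      using sym'[of x y] by (metis inner_commute inner_matrix_vector_transpose)
    then have "transpose W *v x = W *v x" for x
      by (metis vector_eq_ldot)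
    then have "transpose W = W"
      by (simp only: matrix_eq) simp
    moreover have psd: "0 \<le> x \<bullet> (W *v x)" for x
      using W_psd[of "outer x x"] by (simp add: inner_outer outer_mult_vec inner_commute)
    moreover have "C ** W = 0"
    proof -
      have "transpose C ** C \<in> D"
        using D_I[of 1 0] zero linear_0[OF S_lin] by simp
      \<comment> \<open>The rank-one matrix of a row of \<open>C\<close> is dominated by
        \<open>transpose C ** C\<close>, on which \<open>W\<close> is nonpositive; hence the form of
        \<open>W\<close> vanishes at every row.\<close>
      have "W *v C $ k = 0" for k
      proof (rule psd_form_zero_imp_kernel[OF \<open>transpose W = W\<close> psd])
        have "(C $ k \<bullet> x)\<^sup>2 \<le> (norm (C *v x))\<^sup>2" for x
          using component_le_norm_cart[of "C *v x" k]
          by (simp add: matrix_vector_mul_component power2_le_iff_abs_le)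
        then have "0 \<le> W \<bullet> (transpose C ** C - outer (C $ k) (C $ k))"
          by (intro W_psd) (simp add: matrix_vector_mult_diff_rdistrib inner_simps transpose_mult_form
              outer_mult_vec power2_eq_square inner_commute)
        with W_D[OF \<open>transpose C ** C \<in> D\<close>] psd[of "C $ k"]
        show "C $ k \<bullet> (W *v C $ k) = 0" by (simp add: inner_diff_right inner_outer)
      qed
      moreover have "((C ** W) *v x) $ k = x \<bullet> (W *v C $ k)" for x k
        using sym'[of "C $ k" x] by (simp add: matrix_vector_mul_component flip: matrix_vector_mul_assoc)
      ultimately have "(C ** W) *v x = 0" for x
        by (subst vec_eq_iff) simp
      then show ?thesis by (simp add: matrix_eq)
    qed
    moreover have "W \<bullet> P \<le> W \<bullet> (transpose A ** P ** A)" if "P \<in> \<P>" for P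
    proof -
      have "S P \<in> D" using D_I[of 0 P] that by simp
      then show ?thesis using W_D[of "S P"] by (simp add: S_def inner_diff_right)
    qed
    ultimately show ?thesis using multiplier W(1) by blast
  qed
qed

subsection \<open>Eigenvalues modulo the kernel of a matrix\<close>

text \<open>The vector \<open>p(M) x\<close>, with powers of \<open>M\<close> taken as iterates of
  its action on \<open>x\<close>; this suits induction on \<open>p\<close> with \<open>x\<close>
  varying.\<close>

definition poly_apply :: "complex^'n^'n \<Rightarrow> complex poly \<Rightarrow> complex^'n \<Rightarrow> complex^'n" where
  "poly_apply M p x = (\<Sum>i\<le>degree p. coeff p i *s (((*v) M) ^^ i) x)"

lemma poly_apply_eq_sum:
  assumes "degree p \<le> n"
  shows "poly_apply M p x = (\<Sum>i\<le>n. coeff p i *s (((*v) M) ^^ i) x)"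
  unfolding poly_apply_def using assms
  by (intro sum.mono_neutral_left) (auto simp: coeff_eq_0)

lemma poly_apply_pCons: "poly_apply M (pCons a p) x = a *s x + poly_apply M p (M *v x)"
proof -
  have "poly_apply M (pCons a p) x = (\<Sum>i\<le>Suc (degree p). coeff (pCons a p) i *s (((*v) M) ^^ i) x)"
    by (intro poly_apply_eq_sum) (simp add: degree_pCons_le)
  then show ?thesis
    by (simp only: sum.atMost_Suc_shift) (simp add: poly_apply_def funpow_swap1)
qed

lemma poly_apply_0 [simp]: "poly_apply M 0 x = 0"
  by (simp add: poly_apply_def)

lemma poly_apply_add: "poly_apply M (p + q) x = poly_apply M p x + poly_apply M q x"
  by (induction p q arbitrary: x rule: poly_induct2)
    (simp_all add: poly_apply_pCons algebra_simps vec.scale_left_distrib)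

lemma poly_apply_smult: "poly_apply M (smult a p) x = a *s poly_apply M p x"
  by (induction p arbitrary: x)
    (simp_all add: poly_apply_pCons vec.scale_right_distrib)

lemma poly_apply_diff: "poly_apply M (p - q) x = poly_apply M p x - poly_apply M q x"
  by (metis add_diff_cancel_right' diff_add_cancel poly_apply_add)

lemma poly_apply_diff_arg: "poly_apply M p (x - y) = poly_apply M p x - poly_apply M p y"
  by (induction p arbitrary: x y)
    (simp_all add: poly_apply_pCons vec.scale_right_diff_distrib vec.diff)

lemma poly_apply_scale_arg: "poly_apply M p (a *s x) = a *s poly_apply M p x"
  by (induction p arbitrary: x)
    (simp_all add: poly_apply_pCons vec.scale_right_distrib vec.scale vec.scale_left_commute)

lemma poly_apply_mult_vec: "poly_apply M p (M *v x) = M *v poly_apply M p x"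
  by (induction p arbitrary: x)
    (simp_all add: poly_apply_pCons vec.add vec.scale)

text \<open>The linear factor may act first, which yields a new vector annihilated by
  \<open>q\<close>, or last, which exhibits \<open>poly_apply M q x\<close> as an eigenvector once
  the product annihilates \<open>x\<close>.\<close>

lemma poly_apply_linear_factor:
  "poly_apply M ([:- \<gamma>, 1:] * q) x = poly_apply M q (M *v x - \<gamma> *s x)"
  "poly_apply M ([:- \<gamma>, 1:] * q) x = M *v poly_apply M q x - \<gamma> *s poly_apply M q x"
  by (simp_all add: poly_apply_add poly_apply_smult poly_apply_pCons poly_apply_diff_arg
      poly_apply_scale_arg poly_apply_mult_vec poly_apply_diff)

section \<open>Annihilating polynomials and eigenvalues\<close>

lemma scaleR_conv_smult: "r *\<^sub>R x = complex_of_real r *s x" for x :: "complex^'n"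
  unfolding vec_eq_iff vector_scaleR_component vector_smult_component by (simp add: scaleR_conv_of_real)

text \<open>With \<open>n\<close> the real dimension of the space, the \<open>n + 1\<close> iterates
  of \<open>x\<close> under \<open>M\<close> satisfy a nontrivial linear relation, whose
  coefficients form the polynomial.\<close>

lemma exists_annihilating_poly:
  fixes M :: "complex^'n^'n"
  obtains p where "p \<noteq> 0" "poly_apply M p x = 0"
proof -
  define f where "f i = (((*v) M) ^^ i) x" for i
  define n where "n = DIM(complex^'n)"
  have "\<exists>a :: nat \<Rightarrow> complex. (\<exists>i\<le>n. a i \<noteq> 0) \<and> (\<Sum>i\<le>n. a i *s f i) = 0"
  proof (cases "inj_on f {..n}")
    case True
    then have "card (f ` {..n}) = Suc n" by (simp add: card_image)
    then have "dependent (f ` {..n})"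
      using independent_bound[of "f ` {..n}"] by (auto simp: n_def)
    then obtain u where u: "\<exists>v\<in>f ` {..n}. u v \<noteq> 0" "(\<Sum>v\<in>f ` {..n}. u v *\<^sub>R v) = 0"
      by (auto simp: dependent_finite)
    have "(\<Sum>i\<le>n. complex_of_real (u (f i)) *s f i) = 0"
      using u(2) True by (simp add: sum.reindex scaleR_conv_smult)
    with u(1) show ?thesis
      by (intro exI[of _ "\<lambda>i. complex_of_real (u (f i))"]) auto
  next
    case False
    then obtain i j where ij: "i \<le> n" "j \<le> n" "i \<noteq> j" "f i = f j" by (auto simp: inj_on_def)
    \<comment> \<open>Dependence of the set of iterates says nothing when two of them coincide;
      their difference is then the relation itself.\<close>
    define a where "a k = (if k = i then 1 else if k = j then - 1 else 0 :: complex)" for k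
    have "(\<Sum>k\<le>n. a k *s f k) = (\<Sum>k\<in>{i, j}. a k *s f k)"
      using ij by (intro sum.mono_neutral_right) (auto simp: a_def)
    also have "\<dots> = 0" using ij by (simp add: a_def)
    finally show ?thesis using ij(1) by (intro exI[of _ a]) (auto simp: a_def)
  qed
  then obtain a :: "nat \<Rightarrow> complex" where a: "\<exists>i\<le>n. a i \<noteq> 0" "(\<Sum>i\<le>n. a i *s f i) = 0" by blast
  define p where "p = (\<Sum>i\<le>n. monom (a i) i)"
  have coeff: "coeff p i = (if i \<le> n then a i else 0)" for i
    by (simp add: p_def coeff_sum)
  have "degree p \<le> n" by (rule degree_le) (simp add: coeff)
  then have "poly_apply M p x = (\<Sum>i\<le>n. a i *s f i)"
    by (simp add: poly_apply_eq_sum[of p n] coeff f_def)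
  moreover have "p \<noteq> 0" using a(1) coeff by (metis coeff_0)
  ultimately show ?thesis using that a(2) by metis
qed

text \<open>Linear factors are stripped off an annihilating polynomial of a vector outside the kernel of
  \<open>W\<close>: a factor \<open>M - \<gamma>\<close> is either injective on the remaining product, or \<open>\<gamma>\<close> is an eigenvalue and
  the factor maps the vector into the kernel, or the image replaces the vector.\<close>
lemma eigenvalue_modulo_kernel:
  fixes M :: "complex^'n^'n" and W :: "complex^'n^'k"
  assumes "W \<noteq> 0"
  obtains \<gamma> x y where "W *v x \<noteq> 0" "W *v (M *v x) = \<gamma> *s (W *v x)" "y \<noteq> 0" "M *v y = \<gamma> *s y"
proof -
  have "\<exists>\<gamma> x y. W *v x \<noteq> 0 \<and> W *v (M *v x) = \<gamma> *s (W *v x) \<and> y \<noteq> 0 \<and> M *v y = \<gamma> *s y"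
    if "p \<noteq> 0" "poly_apply M p x = 0" "W *v x \<noteq> 0" for p x
    using that
  proof (induction "degree p" arbitrary: p x)
    case 0
    \<comment> \<open>A nonzero constant annihilates only the zero vector, which \<open>W\<close>
      would send to zero.\<close>
    then obtain a where "p = [:a:]" by (metis degree_eq_zeroE)
    with "0.prems" show ?case by (auto simp: poly_apply_pCons)
  next
    case (Suc n)
    have "\<not> constant (poly p)"
      using Suc.hyps(2) by (simp add: constant_degree)
    then obtain \<gamma> where "poly p \<gamma> = 0" using fundamental_theorem_of_algebra by blast
    then obtain q where q: "p = [:- \<gamma>, 1:] * q"
      by (metis dvdE poly_eq_0_iff_dvd)
    have "q \<noteq> 0" using q Suc.prems(1) by auto
    then have deg: "n = degree q" using Suc.hyps(2) unfolding q by (subst (asm) degree_mult_eq) auto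
    define x' where "x' = M *v x - \<gamma> *s x"
    show ?case
    proof (cases "poly_apply M q x = 0")
      case True
      then show ?thesis using Suc.hyps(1)[OF deg] \<open>q \<noteq> 0\<close> Suc.prems(3) by blast
    next
      case False
      have eig: "M *v poly_apply M q x = \<gamma> *s poly_apply M q x"
        using Suc.prems(2) unfolding q poly_apply_linear_factor(2) by simp
      show ?thesis
      proof (cases "W *v x' = 0")
        case True
        then have "W *v (M *v x) = \<gamma> *s (W *v x)"
          by (simp add: x'_def vec.diff vec.scale)
        with False eig Suc.prems(3) show ?thesis by blast
      next
        case W': False
        have "poly_apply M q x' = 0"
          using Suc.prems(2) unfolding q poly_apply_linear_factor(1) x'_def .
        then show ?thesis using Suc.hyps(1)[OF deg] \<open>q \<noteq> 0\<close> W' by blast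
      qed
    qed
  qed
  moreover obtain x where "W *v x \<noteq> 0" using assms by (metis matrix_eq matrix_vector_mult_0)
  moreover obtain p where "p \<noteq> 0" "poly_apply M p x = 0" using exists_annihilating_poly .
  ultimately show ?thesis using that by metis
qed

text \<open>\<open>M - mat \<gamma>\<close> and its transpose have the same determinant, so both are
  singular or neither is.\<close>

lemma eigenvector_transpose:
  fixes M :: "'a::field^'n^'n"
  assumes "y \<noteq> 0" "transpose M *v y = \<gamma> *s y"
  obtains x where "x \<noteq> 0" "M *v x = \<gamma> *s x"
proof -
  define N where "N = M - mat \<gamma>"
  have mat_vec: "mat \<gamma> *v x = \<gamma> *s x" for x :: "'a^'n"
    by (simp add: vec_eq_iff matrix_vector_mult_def mat_def if_distrib[of "\<lambda>c. c * _"] cong: if_cong)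
  have "transpose N = transpose M - mat \<gamma>"
    by (simp add: N_def transpose_def vec_eq_iff mat_def)
  then have "transpose N *v y = 0"
    using assms(2) by (simp add: matrix_vector_mult_diff_rdistrib mat_vec del: transpose_matrix_vector)
  then have "\<not> invertible (transpose N)"
    using assms(1) by (metis invertible_def matrix_left_invertible_ker)
  then have "\<not> invertible N"
    by (simp add: invertible_det_nz det_transpose)
  then obtain x where "x \<noteq> 0" "N *v x = 0"
    by (metis invertible_left_inverse matrix_left_invertible_ker)
  then show ?thesis using that by (simp add: N_def matrix_vector_mult_diff_rdistrib mat_vec)
qed

subsection \<open>Strict solutions of the Stein inequality\<close>

declare transpose_matrix_vector [simp del] matrix_vector_mul_assoc [simp del]

text \<open>A real matrix acts separately on real and imaginary parts, so identities and
  inequalities for real quadratic forms can be applied to each part of a complex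
  eigenvector.\<close>

definition Re_vec :: "complex^'n \<Rightarrow> real^'n" where "Re_vec x = (\<chi> i. Re (x $ i))"
definition Im_vec :: "complex^'n \<Rightarrow> real^'n" where "Im_vec x = (\<chi> i. Im (x $ i))"

lemma complex_vec_eq_iff: "x = y \<longleftrightarrow> Re_vec x = Re_vec y \<and> Im_vec x = Im_vec y"
  by (auto simp: Re_vec_def Im_vec_def vec_eq_iff complex_eq_iff)

lemma Re_Im_vec_simps [simp]:
  "Re_vec 0 = 0" "Im_vec 0 = 0"
  "Re_vec (complex_matrix M *v x) = M *v Re_vec x"
  "Im_vec (complex_matrix M *v x) = M *v Im_vec x"
  "Re_vec (\<gamma> *s x) = Re \<gamma> *\<^sub>R Re_vec x - Im \<gamma> *\<^sub>R Im_vec x"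
  "Im_vec (\<gamma> *s x) = Im \<gamma> *\<^sub>R Re_vec x + Re \<gamma> *\<^sub>R Im_vec x"
  by (simp_all add: Re_vec_def Im_vec_def vec_eq_iff matrix_vector_mult_def map_matrix_def)

lemma complex_matrix_mult_vec: "complex_matrix (M ** N) *v x = complex_matrix M *v (complex_matrix N *v x)"
  by (simp add: complex_vec_eq_iff flip: matrix_vector_mul_assoc)

lemma complex_matrix_eq_0_iff: "complex_matrix M = 0 \<longleftrightarrow> M = 0"
  by (simp add: vec_eq_iff map_matrix_def)

lemma transpose_complex_matrix: "transpose (complex_matrix M) = complex_matrix (transpose M)"
  by (simp add: vec_eq_iff map_matrix_def transpose_def)

text \<open>The Hermitian form \<open>x\<^sup>* W x\<close>, written through the real and imaginary parts of \<open>x\<close>.\<close>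
definition hermitian_form :: "real^'n^'n \<Rightarrow> complex^'n \<Rightarrow> real" where
  "hermitian_form W x = Re_vec x \<bullet> (W *v Re_vec x) + Im_vec x \<bullet> (W *v Im_vec x)"

text \<open>If both parts had zero form, both would lie in the kernel of \<open>W\<close>, and so
  would \<open>x\<close>.\<close>

lemma hermitian_form_pos:
  assumes "transpose W = W" "\<And>x. 0 \<le> x \<bullet> (W *v x)" "complex_matrix W *v x \<noteq> 0"
  shows "0 < hermitian_form W x"
proof -
  have "Re_vec x \<bullet> (W *v Re_vec x) \<noteq> 0 \<or> Im_vec x \<bullet> (W *v Im_vec x) \<noteq> 0"
    using assms psd_form_zero_imp_kernel[of W] by (auto simp: complex_vec_eq_iff)
  then show ?thesis
    using assms(2)[of "Re_vec x"] assms(2)[of "Im_vec x"] unfolding hermitian_form_def by linarith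
qed

text \<open>Symmetry lets the relation be used once in each slot of the form, which produces
  \<open>\<gamma>\<close> times its conjugate; equality modulo the kernel of \<open>W\<close> is
  enough for this.\<close>

lemma hermitian_form_eigenvector_modulo_kernel:
  fixes W M :: "real^'n^'n"
  assumes sym: "transpose W = W"
    and eig: "complex_matrix W *v (complex_matrix M *v x) = \<gamma> *s (complex_matrix W *v x)"
  shows "hermitian_form W (complex_matrix M *v x) = (cmod \<gamma>)\<^sup>2 * hermitian_form W x"
proof -
  define a b where "a = Re_vec x" and "b = Im_vec x"
  have *: "(M *v p) \<bullet> (W *v q) = q \<bullet> (W *v (M *v p))" for p q
    by (metis inner_commute inner_matrix_vector_transpose sym)
  have "W *v (M *v a) = Re \<gamma> *\<^sub>R (W *v a) - Im \<gamma> *\<^sub>R (W *v b)"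
    "W *v (M *v b) = Im \<gamma> *\<^sub>R (W *v a) + Re \<gamma> *\<^sub>R (W *v b)"
    using eig by (simp_all add: complex_vec_eq_iff a_def b_def)
  then show ?thesis
    by (simp add: hermitian_form_def * inner_add_right inner_diff_right cmod_power2
        flip: a_def b_def) (simp add: power2_eq_square algebra_simps)
qed

section \<open>Solvability from the spectral condition and from detectability\<close>

lemma strict_stein_solution:
  fixes A :: "real^'n^'n" and C :: "real^'n^'p"
  assumes "\<And>\<gamma>. unobservable_eigenvalue A C \<gamma> \<Longrightarrow> cmod \<gamma> \<noteq> 1"
  obtains t P where "0 \<le> t"
    "\<And>x. x \<noteq> 0 \<Longrightarrow> 0 < t * (norm (C *v x))\<^sup>2 + x \<bullet> (P *v x) - (A *v x) \<bullet> (P *v (A *v x))"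
proof (cases rule: matrix_stein_alternative[of UNIV C A, case_names cone storage multiplier])
  case cone
  show ?case by (simp add: convex_cone_iff)
next
  case (storage t P)
  then show ?thesis using that by blast
next
  case (multiplier W)
  \<comment> \<open>Both \<open>P\<close> and \<open>- P\<close> are admissible, so the multiplier
    inequality is an equality; rank-one \<open>P\<close> then turn it into the fixed-point equation
    for \<open>W\<close>.\<close>
  have "W \<bullet> P = W \<bullet> (transpose A ** P ** A)" for P
  proof -
    have "(- N) *v x = - (N *v x)" for N :: "real^'n^'n" and x
      using matrix_vector_mult_diff_rdistrib[of 0 N x] by simp
    then have "transpose A ** (- P) ** A = - (transpose A ** P ** A)"
      by (simp add: matrix_eq vec.neg flip: matrix_vector_mul_assoc)
    then show ?thesis
      using multiplier(5)[of P] multiplier(5)[of "- P"] by simp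
  qed
  then have *: "x \<bullet> (W *v y) = (transpose A *v x) \<bullet> (W *v (transpose A *v y))" for x y
    by (metis inner_outer outer_congruence)
  then have "x \<bullet> (W *v y) = x \<bullet> (A *v (W *v (transpose A *v y)))" for x y
    by (metis inner_matrix_vector_transpose transpose_transpose)
  then have fixed: "W *v y = A *v (W *v (transpose A *v y))" for y
    by (metis vector_eq_ldot)
  obtain \<gamma> x where x: "complex_matrix W *v x \<noteq> 0"
    "complex_matrix W *v (complex_matrix (transpose A) *v x) = \<gamma> *s (complex_matrix W *v x)"
    using eigenvalue_modulo_kernel[of "complex_matrix W" "complex_matrix (transpose A)"] multiplier(1)
    unfolding complex_matrix_eq_0_iff by blast
  define y where "y = complex_matrix W *v x"
  have "hermitian_form W (complex_matrix (transpose A) *v x) = hermitian_form W x"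
    by (simp add: hermitian_form_def flip: *)
  then have "(cmod \<gamma>)\<^sup>2 = 1"
    using hermitian_form_eigenvector_modulo_kernel[OF multiplier(2) x(2)]
      hermitian_form_pos[OF multiplier(2,3) x(1)] by simp
  then have "cmod \<gamma> = 1" using norm_ge_zero[of \<gamma>] unfolding power2_eq_1_iff by linarith
  \<comment> \<open>The vector \<open>\<gamma> *s y\<close> is \<open>W\<close> applied to the
    transposed image of \<open>x\<close>, and the fixed-point equation says that \<open>A\<close>
    carries it back to \<open>y\<close>.\<close>
  have "complex_matrix A *v (\<gamma> *s y) = y"
    unfolding y_def x(2)[symmetric]
    by (simp add: complex_vec_eq_iff fixed[symmetric])
  then have "inverse \<gamma> *s (\<gamma> *s (complex_matrix A *v y)) = inverse \<gamma> *s y"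
    by (simp only: vec.scale)
  moreover have "\<gamma> \<noteq> 0" using \<open>cmod \<gamma> = 1\<close> by auto
  ultimately have "complex_matrix A *v y = inverse \<gamma> *s y"
    by simp
  moreover have "complex_matrix C *v y = 0"
    unfolding y_def by (simp add: multiplier(4) flip: complex_matrix_mult_vec) (simp add: complex_vec_eq_iff)
  ultimately have "unobservable_eigenvalue A C (inverse \<gamma>)"
    using x(1) by (auto simp: unobservable_eigenvalue_def eigenvector_def y_def)
  then show ?thesis using assms \<open>cmod \<gamma> = 1\<close> by (metis inverse_1 norm_inverse)
qed

lemma detectable_strict_stein_solution:
  fixes A :: "real^'n^'n" and C :: "real^'n^'p"
  assumes "detectable A C"
  obtains t P where "0 \<le> t" "\<And>x. 0 \<le> x \<bullet> (P *v x)"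
    "\<And>x. x \<noteq> 0 \<Longrightarrow> 0 < t * (norm (C *v x))\<^sup>2 + x \<bullet> (P *v x) - (A *v x) \<bullet> (P *v (A *v x))"
proof (cases rule: matrix_stein_alternative[of "{P. \<forall>x. 0 \<le> x \<bullet> (P *v x)}" C A,
      case_names cone storage multiplier])
  case cone
  show ?case
    by (auto simp: convex_cone_iff matrix_vector_mult_add_rdistrib inner_add_right
        simp flip: scaleR_matrix_vector_assoc)
next
  case (storage t P)
  then show ?thesis using that by blast
next
  case (multiplier W)
  obtain L where schur: "schur_stable (A + L ** C)" using assms by (auto simp: detectable_def)
  define M where "M = transpose (A + L ** C)"
  \<comment> \<open>Since \<open>W\<close> is symmetric it also kills the range of
    \<open>transpose C\<close>; the output injection is therefore invisible to \<open>W\<close>, and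
    \<open>M\<close> may replace \<open>transpose A\<close>.\<close>
  have "W ** transpose C = 0"
    using arg_cong[OF multiplier(4), of transpose]
    by (simp add: matrix_transpose_mul multiplier(2)) (simp add: transpose_def vec_eq_iff)
  then have WM: "W *v (M *v x) = W *v (transpose A *v x)" for x
  proof -
    have "W *v (transpose C *v u) = 0" for u
      using \<open>W ** transpose C = 0\<close> by (simp add: matrix_vector_mul_assoc)
    moreover have "M *v x = transpose A *v x + transpose C *v (transpose L *v x)"
    proof (rule vector_eq_ldot[THEN iffD1], rule allI)
      fix w
      show "w \<bullet> (M *v x) = w \<bullet> (transpose A *v x + transpose C *v (transpose L *v x))"
        by (simp add: M_def inner_add_right inner_add_left matrix_vector_mult_add_rdistrib
            flip: inner_matrix_vector_transpose matrix_vector_mul_assoc)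
    qed
    ultimately show ?thesis by (simp add: matrix_vector_right_distrib)
  qed
  have grow: "x \<bullet> (W *v x) \<le> (M *v x) \<bullet> (W *v (M *v x))" for x
  proof -
    have "x \<bullet> (W *v x) \<le> (transpose A *v x) \<bullet> (W *v (transpose A *v x))"
      using multiplier(5)[of "outer x x"]
      by (simp add: inner_outer outer_congruence outer_mult_vec inner_commute)
    \<comment> \<open>The form depends on its argument only through the image under
      \<open>W\<close>, so \<open>WM\<close> applies in both slots.\<close>
    also have "\<dots> = (M *v x) \<bullet> (W *v (M *v x))"
      by (metis WM inner_commute inner_matrix_vector_transpose multiplier(2))
    finally show ?thesis .
  qed
  obtain \<gamma> x y where x: "complex_matrix W *v x \<noteq> 0"
      "complex_matrix W *v (complex_matrix M *v x) = \<gamma> *s (complex_matrix W *v x)"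
    and y: "y \<noteq> 0" "complex_matrix M *v y = \<gamma> *s y"
    using eigenvalue_modulo_kernel[of "complex_matrix W" "complex_matrix M"] multiplier(1)
    unfolding complex_matrix_eq_0_iff by blast
  \<comment> \<open>Schur stability concerns \<open>A + L ** C\<close>, whereas
    \<open>\<gamma>\<close> was found as an eigenvalue of its transpose.\<close>
  obtain w where "w \<noteq> 0" "complex_matrix (A + L ** C) *v w = \<gamma> *s w"
    using eigenvector_transpose[of y "complex_matrix (A + L ** C)" \<gamma>] y
    unfolding M_def transpose_complex_matrix by blast
  then have "cmod \<gamma> < 1" using schur by (auto simp: schur_stable_def eigenvector_def)
  have "hermitian_form W x \<le> hermitian_form W (complex_matrix M *v x)"
    using grow[of "Re_vec x"] grow[of "Im_vec x"] by (simp add: hermitian_form_def)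
  also have "\<dots> = (cmod \<gamma>)\<^sup>2 * hermitian_form W x"
    by (rule hermitian_form_eigenvector_modulo_kernel[OF multiplier(2) x(2)])
  also have "\<dots> < 1 * hermitian_form W x"
    using hermitian_form_pos[OF multiplier(2,3) x(1)] \<open>cmod \<gamma> < 1\<close>
    by (intro mult_strict_right_mono) (auto simp: power_less_one_iff abs_square_less_1)
  finally show ?thesis by simp
qed

subsection \<open>Storage functions\<close>

text \<open>The constant is the minimum of \<open>q\<close> on the compact unit sphere; homogeneity
  extends the bound to all vectors.\<close>

lemma quadratic_coercive:
  fixes q :: "'a::euclidean_space \<Rightarrow> real"
  assumes cont: "continuous_on UNIV q" and hom: "\<And>a x. q (a *\<^sub>R x) = a\<^sup>2 * q x"
    and pos: "\<And>x. x \<noteq> 0 \<Longrightarrow> 0 < q x"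
  obtains \<eta> where "0 < \<eta>" "\<And>x. \<eta> * (norm x)\<^sup>2 \<le> q x"
proof -
  have "sphere (0::'a) 1 \<noteq> {}" by simp
  moreover have "continuous_on (sphere 0 1) q" using cont continuous_on_subset by blast
  ultimately obtain e where e: "e \<in> sphere 0 1" "\<And>x. x \<in> sphere 0 1 \<Longrightarrow> q e \<le> q x"
    using continuous_attains_inf[of "sphere 0 1" q] by (metis compact_sphere)
  have "q e * (norm x)\<^sup>2 \<le> q x" for x
  proof (cases "x = 0")
    case True
    then show ?thesis using hom[of 0 x] by simp
  next
    case False
    then have "q e \<le> q (x /\<^sub>R norm x)" by (intro e(2)) simp
    also have "\<dots> = q x / (norm x)\<^sup>2" by (simp add: hom power_inverse divide_inverse)
    finally show ?thesis using False by (simp add: pos_le_divide_eq)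
  qed
  moreover have "0 < q e" using e(1) by (intro pos) auto
  ultimately show ?thesis using that by blast
qed

lemma matrix_vector_norm_bound:
  fixes A :: "real^'n^'m"
  obtains a where "0 < a" "\<And>x. norm (A *v x) \<le> a * norm x"
  using bounded_linear.pos_bounded[OF matrix_vector_mul_bounded_linear[of A]] by (metis mult.commute)

lemma continuous_on_matrix_vector [continuous_intros]:
  fixes A :: "real^'n^'m"
  shows "continuous_on S f \<Longrightarrow> continuous_on S (\<lambda>x. A *v f x)"
  by (rule bounded_linear.continuous_on[OF matrix_vector_mul_bounded_linear])

lemma stein_form_coercive:
  fixes A P :: "real^'n^'n" and C :: "real^'n^'p"
  assumes "\<And>x. x \<noteq> 0 \<Longrightarrow> 0 < t * (norm (C *v x))\<^sup>2 + x \<bullet> (P *v x) - (A *v x) \<bullet> (P *v (A *v x))"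
  obtains \<eta> where "0 < \<eta>"
    "\<And>x. \<eta> * (norm x)\<^sup>2 \<le> t * (norm (C *v x))\<^sup>2 + x \<bullet> (P *v x) - (A *v x) \<bullet> (P *v (A *v x))"
proof (rule quadratic_coercive)
  show "continuous_on UNIV (\<lambda>x. t * (norm (C *v x))\<^sup>2 + x \<bullet> (P *v x) - (A *v x) \<bullet> (P *v (A *v x)))"
    by (intro continuous_intros)
qed (use assms that in \<open>auto simp: matrix_vector_mult_scaleR power_mult_distrib power2_eq_square algebra_simps\<close>)

text \<open>A semidefinite \<open>P\<close> cannot dominate a linear term in the storage function.
  Strictness of the Stein inequality leaves room to add a multiple of the identity.\<close>

lemma detectable_coercive_stein_solution:
  fixes A :: "real^'n^'n" and C :: "real^'n^'p"
  assumes "detectable A C"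
  obtains t P \<rho> where "0 \<le> t" "0 < \<rho>" "\<And>x. \<rho> * (norm x)\<^sup>2 \<le> x \<bullet> (P *v x)"
    "\<And>x. x \<noteq> 0 \<Longrightarrow> 0 < t * (norm (C *v x))\<^sup>2 + x \<bullet> (P *v x) - (A *v x) \<bullet> (P *v (A *v x))"
proof -
  obtain t P where t: "0 \<le> t" and psd: "\<And>x. 0 \<le> x \<bullet> (P *v x)"
    and pos: "\<And>x. x \<noteq> 0 \<Longrightarrow> 0 < t * (norm (C *v x))\<^sup>2 + x \<bullet> (P *v x) - (A *v x) \<bullet> (P *v (A *v x))"
    using detectable_strict_stein_solution[OF assms] by blast
  obtain \<eta> where \<eta>: "0 < \<eta>"
    "\<And>x. \<eta> * (norm x)\<^sup>2 \<le> t * (norm (C *v x))\<^sup>2 + x \<bullet> (P *v x) - (A *v x) \<bullet> (P *v (A *v x))"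
    using stein_form_coercive[OF pos] by blast
  obtain a where a: "0 < a" "\<And>x. norm (A *v x) \<le> a * norm x"
    using matrix_vector_norm_bound[of A] by blast
  \<comment> \<open>With this value the added successor term
    \<open>\<rho> * (norm (A *v x))\<^sup>2\<close> is absorbed by the margin \<open>\<eta>\<close>,
    and the added \<open>\<rho> * (norm x)\<^sup>2\<close> keeps the inequality strict.\<close>
  define \<rho> where "\<rho> = \<eta> / a\<^sup>2"
  define P' where "P' = P + \<rho> *\<^sub>R mat 1"
  have "0 < \<rho>" using \<eta>(1) a(1) by (simp add: \<rho>_def)
  have form: "x \<bullet> (P' *v x) = x \<bullet> (P *v x) + \<rho> * (norm x)\<^sup>2" for x
    by (simp add: P'_def matrix_vector_mult_add_rdistrib inner_add_right power2_norm_eq_inner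
        flip: scaleR_matrix_vector_assoc)
  have "0 < t * (norm (C *v x))\<^sup>2 + x \<bullet> (P' *v x) - (A *v x) \<bullet> (P' *v (A *v x))" if "x \<noteq> 0" for x
  proof -
    have "\<rho> * (norm (A *v x))\<^sup>2 \<le> \<rho> * (a * norm x)\<^sup>2"
      using a(2)[of x] \<open>0 < \<rho>\<close> by (intro mult_left_mono power_mono) auto
    also have "\<dots> = \<eta> * (norm x)\<^sup>2" using a(1) by (simp add: \<rho>_def power_mult_distrib)
    finally have "\<rho> * (norm (A *v x))\<^sup>2 \<le> \<eta> * (norm x)\<^sup>2" .
    moreover have "0 < \<rho> * (norm x)\<^sup>2" using \<open>0 < \<rho>\<close> that by simp
    ultimately show ?thesis unfolding form using \<eta>(2)[of x] by linarith
  qed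
  moreover have "\<rho> * (norm x)\<^sup>2 \<le> x \<bullet> (P' *v x)" for x using psd[of x] by (simp add: form)
  ultimately show ?thesis using that t \<open>0 < \<rho>\<close> by blast
qed

text \<open>The mixed terms in state and input are split by Young's inequality between the state
  margin and the input cost; a small factor \<open>\<delta>\<close> makes the available stage cost
  sufficient.\<close>

lemma scaled_storage_form:
  fixes A P :: "real^'n^'n" and B :: "real^'m^'n" and C :: "real^'n^'p" and R :: "real^'m^'m"
  assumes t: "0 \<le> t"
    and pos: "\<And>x. x \<noteq> 0 \<Longrightarrow> 0 < t * (norm (C *v x))\<^sup>2 + x \<bullet> (P *v x) - (A *v x) \<bullet> (P *v (A *v x))"
    and R: "\<And>u. u \<noteq> 0 \<Longrightarrow> 0 < u \<bullet> (R *v u)"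
  obtains \<delta> \<epsilon> where "0 < \<delta>" "0 < \<epsilon>"
    "\<And>x u. \<delta> * ((A *v x + B *v u) \<bullet> (P *v (A *v x + B *v u))) \<le>
       \<delta> * (x \<bullet> (P *v x)) + (norm (C *v x))\<^sup>2 + u \<bullet> (R *v u) - \<epsilon> * ((norm x)\<^sup>2 + (norm u)\<^sup>2)"
proof -
  obtain \<eta> where \<eta>: "0 < \<eta>"
    "\<And>x. \<eta> * (norm x)\<^sup>2 \<le> t * (norm (C *v x))\<^sup>2 + x \<bullet> (P *v x) - (A *v x) \<bullet> (P *v (A *v x))"
    using stein_form_coercive[OF pos] by blast
  obtain \<kappa> where \<kappa>: "0 < \<kappa>" "\<And>u. \<kappa> * (norm u)\<^sup>2 \<le> u \<bullet> (R *v u)"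
  proof (rule quadratic_coercive)
    show "continuous_on UNIV (\<lambda>u. u \<bullet> (R *v u))" by (intro continuous_intros)
  qed (use R in \<open>auto simp: matrix_vector_mult_scaleR power2_eq_square\<close>)
  obtain a where a: "0 < a" "\<And>x. norm (A *v x) \<le> a * norm x"
    using matrix_vector_norm_bound[of A] by blast
  obtain b where b: "0 < b" "\<And>x. norm (B *v x) \<le> b * norm x"
    using matrix_vector_norm_bound[of B] by blast
  obtain p where p: "0 < p" "\<And>x. norm (P *v x) \<le> p * norm x"
    using matrix_vector_norm_bound[of P] by blast
  have form: "r \<bullet> (P *v s) \<le> p * (k * l)" if "norm r \<le> k" "norm s \<le> l" for r s k l
  proof -
    have "r \<bullet> (P *v s) \<le> norm r * norm (P *v s)" by (rule norm_cauchy_schwarz)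
    also have "\<dots> \<le> k * (p * l)"
      using that p(1) p(2)[of s] norm_ge_zero[of r] norm_ge_zero[of s]
      by (intro mult_mono) (auto intro: order_trans[OF _ mult_left_mono] order_trans[of 0 "norm r" k])
    finally show ?thesis by (simp add: mult_ac)
  qed
  \<comment> \<open>\<open>m\<close> bounds the two mixed terms and \<open>s\<close> the pure input
    term; \<open>k\<close> is the total coefficient of the squared input norm after half of
    \<open>\<eta>\<close> is spent on the mixed terms.\<close>
  define m where "m = 2 * (p * (a * b))"
  define s where "s = p * (b * b)"
  define k where "k = m\<^sup>2 / (2 * \<eta>) + s"
  have "0 \<le> k" using a b p \<eta> by (simp add: k_def s_def)
  \<comment> \<open>The first bound gives \<open>\<delta> * t \<le> 1\<close>, so one copy of the
    squared norm of \<open>C *v x\<close> suffices; the second gives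
    \<open>\<delta> * k \<le> \<kappa> / 2\<close>, so half of the input cost remains for
    \<open>\<epsilon>\<close>.\<close>
  define \<delta> where "\<delta> = min (1 / (t + 1)) (\<kappa> / (2 * (k + 1)))"
  define \<epsilon> where "\<epsilon> = min (\<delta> * \<eta> / 2) (\<kappa> / 2)"
  have "0 < \<delta>" using t \<kappa> \<open>0 \<le> k\<close> by (simp add: \<delta>_def)
  have \<delta>t: "\<delta> * t \<le> 1"
  proof -
    have "\<delta> * t \<le> 1 / (t + 1) * t" using t by (intro mult_right_mono) (auto simp: \<delta>_def)
    also have "\<dots> \<le> 1" using t by (simp add: field_simps)
    finally show ?thesis .
  qed
  have \<delta>k: "\<delta> * k \<le> \<kappa> / 2"
  proof -
    have "\<delta> * k \<le> \<kappa> / (2 * (k + 1)) * k" using \<open>0 \<le> k\<close> by (intro mult_right_mono) (auto simp: \<delta>_def)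
    also have "\<dots> \<le> \<kappa> / 2" using \<open>0 \<le> k\<close> \<kappa>(1) by (simp add: field_simps)
    finally show ?thesis .
  qed
  have "0 < \<epsilon>" using \<open>0 < \<delta>\<close> \<eta> \<kappa> by (simp add: \<epsilon>_def)
  moreover have "\<delta> * ((A *v x + B *v u) \<bullet> (P *v (A *v x + B *v u))) \<le>
       \<delta> * (x \<bullet> (P *v x)) + (norm (C *v x))\<^sup>2 + u \<bullet> (R *v u) - \<epsilon> * ((norm x)\<^sup>2 + (norm u)\<^sup>2)"
    (is "\<delta> * ?lhs \<le> _") for x u
  proof -
    define X U where "X = norm x" and "U = norm u"
    have "?lhs = (A *v x) \<bullet> (P *v (A *v x)) + (A *v x) \<bullet> (P *v (B *v u)) +
        (B *v u) \<bullet> (P *v (A *v x)) + (B *v u) \<bullet> (P *v (B *v u))"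
      by (simp add: matrix_vector_right_distrib inner_add_left inner_add_right)
    also have "\<dots> \<le> (A *v x) \<bullet> (P *v (A *v x)) + p * ((a * X) * (b * U)) +
        p * ((b * U) * (a * X)) + p * ((b * U) * (b * U))"
      unfolding X_def U_def by (intro add_mono form a b order_refl)
    also have "\<dots> = (A *v x) \<bullet> (P *v (A *v x)) + m * X * U + s * U\<^sup>2"
      by (simp add: m_def s_def power2_eq_square algebra_simps)
    also have "m * X * U \<le> \<eta> / 2 * X\<^sup>2 + m\<^sup>2 / (2 * \<eta>) * U\<^sup>2"
    proof -
      have "0 \<le> (\<eta> * X - m * U)\<^sup>2 / (2 * \<eta>)" using \<eta>(1) by simp
      also have "\<dots> = \<eta> / 2 * X\<^sup>2 + m\<^sup>2 / (2 * \<eta>) * U\<^sup>2 - m * X * U"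
        using \<eta>(1) by (simp add: power2_eq_square field_simps)
      finally show ?thesis by simp
    qed
    finally have "?lhs \<le> (A *v x) \<bullet> (P *v (A *v x)) + \<eta> / 2 * X\<^sup>2 + k * U\<^sup>2"
      by (simp add: k_def algebra_simps)
    also have "\<dots> \<le> t * (norm (C *v x))\<^sup>2 + x \<bullet> (P *v x) - \<eta> / 2 * X\<^sup>2 + k * U\<^sup>2"
      using \<eta>(2)[of x] by (simp add: X_def)
    finally have "\<delta> * ?lhs \<le> \<delta> * (t * (norm (C *v x))\<^sup>2 + x \<bullet> (P *v x) - \<eta> / 2 * X\<^sup>2 + k * U\<^sup>2)"
      using \<open>0 < \<delta>\<close> by simp
    also have "\<dots> = (\<delta> * t) * (norm (C *v x))\<^sup>2 + \<delta> * (x \<bullet> (P *v x)) - \<delta> * \<eta> / 2 * X\<^sup>2 + (\<delta> * k) * U\<^sup>2"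
      by (simp add: algebra_simps)
    also have "\<dots> \<le> 1 * (norm (C *v x))\<^sup>2 + \<delta> * (x \<bullet> (P *v x)) - \<epsilon> * X\<^sup>2 + \<kappa> / 2 * U\<^sup>2"
    proof -
      have "(\<delta> * t) * (norm (C *v x))\<^sup>2 \<le> 1 * (norm (C *v x))\<^sup>2" "(\<delta> * k) * U\<^sup>2 \<le> \<kappa> / 2 * U\<^sup>2"
        "\<epsilon> * X\<^sup>2 \<le> \<delta> * \<eta> / 2 * X\<^sup>2"
        by (intro mult_right_mono \<delta>t \<delta>k zero_le_power2; simp add: \<epsilon>_def)+
      then show ?thesis by linarith
    qed
    also have "\<kappa> / 2 * U\<^sup>2 \<le> u \<bullet> (R *v u) - \<epsilon> * U\<^sup>2"
    proof -
      have "\<epsilon> * U\<^sup>2 \<le> \<kappa> / 2 * U\<^sup>2" by (intro mult_right_mono) (auto simp: \<epsilon>_def)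
      then show ?thesis using \<kappa>(2)[of u] by (simp add: U_def)
    qed
    finally show ?thesis by (simp add: X_def U_def algebra_simps)
  qed
  ultimately show ?thesis using that \<open>0 < \<delta>\<close> by blast
qed

text \<open>The quadratic cost is expanded exactly about the steady state. Stationarity replaces its
  gradient by the multiplier terms, and the term of the inequality constraint has a favourable sign
  on the constraint set.\<close>

lemma KKT_rotated_cost:
  fixes A :: "real^'n^'n" and B :: "real^'m^'n" and C :: "real^'n^'n" and K :: "real^'m^'m"
  assumes KKT: "KKT A B C K z v g (x\<^sub>e, u\<^sub>e)"
  obtains lam where "\<And>x u. g (x, u) \<le> 0 \<Longrightarrow>
    lq_cost (transpose C ** C) (transpose K ** K) z v c (x\<^sub>e, u\<^sub>e) +
      (norm (C *v (x - x\<^sub>e)))\<^sup>2 + (u - u\<^sub>e) \<bullet> ((transpose K ** K) *v (u - u\<^sub>e)) + lam \<bullet> (x - (A *v x + B *v u))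
    \<le> lq_cost (transpose C ** C) (transpose K ** K) z v c (x, u)"
proof -
  define Q where "Q = transpose C ** C"
  define R where "R = transpose K ** K"
  have symQ: "x \<bullet> (Q *v y) = y \<bullet> (Q *v x)" for x y
    unfolding Q_def by (metis inner_commute inner_matrix_vector_transpose matrix_vector_mul_assoc)
  have symR: "x \<bullet> (R *v y) = y \<bullet> (R *v x)" for x y
    unfolding R_def by (metis inner_commute inner_matrix_vector_transpose matrix_vector_mul_assoc)
  from KKT obtain lam \<mu> \<nu> where sub: "subgradient g (x\<^sub>e, u\<^sub>e) \<nu>"
    and stat: "(2 *\<^sub>R (Q *v x\<^sub>e) + 2 *\<^sub>R z, 2 *\<^sub>R (R *v u\<^sub>e) + 2 *\<^sub>R v)
         + ((transpose A - mat 1) *v lam, transpose B *v lam) + \<mu> *\<^sub>R \<nu> = 0"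
    and steady: "A *v x\<^sub>e + B *v u\<^sub>e = x\<^sub>e" and \<mu>: "0 \<le> \<mu>" "g (x\<^sub>e, u\<^sub>e) * \<mu> = 0"
    unfolding KKT_def Q_def R_def by blast
  have "lq_cost Q R z v c (x\<^sub>e, u\<^sub>e) + (norm (C *v (x - x\<^sub>e)))\<^sup>2 + (u - u\<^sub>e) \<bullet> (R *v (u - u\<^sub>e)) +
      lam \<bullet> (x - (A *v x + B *v u)) \<le> lq_cost Q R z v c (x, u)" if "g (x, u) \<le> 0" for x u
  proof -
    define d e where "d = x - x\<^sub>e" and "e = u - u\<^sub>e"
    have xu: "x = x\<^sub>e + d" "u = u\<^sub>e + e" by (simp_all add: d_def e_def)
    \<comment> \<open>The subgradient inequality is weighted by \<open>\<mu>\<close>; complementary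
      slackness removes the value of \<open>g\<close> at the steady state.\<close>
    have "\<mu> * (\<nu> \<bullet> (d, e)) \<le> \<mu> * (g (x, u) - g (x\<^sub>e, u\<^sub>e))"
      using sub[unfolded subgradient_def, rule_format, of "(x, u)"] \<mu>(1)
      by (intro mult_left_mono) (simp_all add: d_def e_def)
    also have "\<dots> = \<mu> * g (x, u)" using \<mu>(2) by (auto simp: algebra_simps)
    also have "\<dots> \<le> 0" using that \<mu>(1) by (simp add: mult_nonneg_nonpos)
    finally have \<nu>: "\<mu> * (\<nu> \<bullet> (d, e)) \<le> 0" .
    have trans: "(transpose A *v lam) \<bullet> d = lam \<bullet> (A *v d)" "(transpose B *v lam) \<bullet> e = lam \<bullet> (B *v e)"
      by (metis inner_commute inner_matrix_vector_transpose)+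
    \<comment> \<open>Stationarity is tested against the displacement \<open>(d, e)\<close>.\<close>
    have "0 = ((2 *\<^sub>R (Q *v x\<^sub>e) + 2 *\<^sub>R z, 2 *\<^sub>R (R *v u\<^sub>e) + 2 *\<^sub>R v)
         + ((transpose A - mat 1) *v lam, transpose B *v lam) + \<mu> *\<^sub>R \<nu>) \<bullet> (d, e)"
      unfolding stat by simp
    also have "\<dots> = 2 * ((Q *v x\<^sub>e) \<bullet> d) + 2 * (z \<bullet> d) + 2 * ((R *v u\<^sub>e) \<bullet> e) + 2 * (v \<bullet> e)
        + lam \<bullet> (A *v d + B *v e - d) + \<mu> * (\<nu> \<bullet> (d, e))"
      by (simp add: inner_add_left inner_add_right inner_diff_left inner_diff_right
          matrix_vector_mult_diff_rdistrib trans)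
    finally have "0 = \<dots>" .
    moreover have "lam \<bullet> (x - (A *v x + B *v u)) = - (lam \<bullet> (A *v d + B *v e - d))"
    proof -
      have "x - (A *v x + B *v u) = - (A *v d + B *v e - d)"
        using steady by (simp add: xu matrix_vector_right_distrib algebra_simps)
      then show ?thesis by (simp only: inner_minus_right)
    qed
    moreover have "x \<bullet> (Q *v x) = x\<^sub>e \<bullet> (Q *v x\<^sub>e) + 2 * ((Q *v x\<^sub>e) \<bullet> d) + (norm (C *v d))\<^sup>2"
      using symQ[of x\<^sub>e d]
      by (simp add: xu matrix_vector_right_distrib inner_add_left inner_add_right inner_commute
          flip: transpose_mult_form[of d C] Q_def)
    moreover have "u \<bullet> (R *v u) = u\<^sub>e \<bullet> (R *v u\<^sub>e) + 2 * ((R *v u\<^sub>e) \<bullet> e) + e \<bullet> (R *v e)"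
      using symR[of u\<^sub>e e]
      by (simp add: xu matrix_vector_right_distrib inner_add_left inner_add_right inner_commute)
    moreover have "z \<bullet> x = z \<bullet> x\<^sub>e + z \<bullet> d" "v \<bullet> u = v \<bullet> u\<^sub>e + v \<bullet> e"
      by (simp_all add: xu inner_add_right)
    ultimately show ?thesis
      using \<nu> unfolding lq_cost_def d_def[symmetric] e_def[symmetric] by simp
  qed
  then show ?thesis using that unfolding Q_def R_def by blast
qed

section \<open>Assembly of the storage functions\<close>

lemma is_norm_norm: "is_norm (norm :: 'a::real_normed_vector \<Rightarrow> real)"
  by (simp add: is_norm_def norm_triangle_ineq)

lemma scaled_square_in_class_K: "0 < \<epsilon> \<Longrightarrow> (\<lambda>r. \<epsilon> * r\<^sup>2) \<in> class_K"
  by (auto simp: class_K_def strict_mono_on_def power_strict_mono intro!: continuous_intros)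

text \<open>The increment of the linear part equals the multiplier term of the rotated cost, and the
  increment of the quadratic part is paid by its squared terms up to \<open>\<epsilon>\<close> times
  the squared distance.\<close>

lemma quadratic_strict_storage:
  fixes A P C :: "real^'n^'n" and B :: "real^'m^'n" and K :: "real^'m^'m"
  assumes R: "pos_definite (transpose K ** K)"
    and KKT: "KKT A B C K z v g (x\<^sub>e, u\<^sub>e)"
    and t: "0 \<le> t"
    and pos: "\<And>x. x \<noteq> 0 \<Longrightarrow> 0 < t * (norm (C *v x))\<^sup>2 + x \<bullet> (P *v x) - (A *v x) \<bullet> (P *v (A *v x))"
  obtains \<delta> lam where "0 < \<delta>"
    "strict_storage (CLQ A B (transpose C ** C) (transpose K ** K) z v c g) (x\<^sub>e, u\<^sub>e)
       (\<lambda>x. \<delta> * ((x - x\<^sub>e) \<bullet> (P *v (x - x\<^sub>e))) - lam \<bullet> x)"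
proof -
  obtain \<delta> \<epsilon> where \<delta>: "0 < \<delta>" and \<epsilon>: "0 < \<epsilon>"
    and form: "\<And>x u. \<delta> * ((A *v x + B *v u) \<bullet> (P *v (A *v x + B *v u))) \<le>
       \<delta> * (x \<bullet> (P *v x)) + (norm (C *v x))\<^sup>2 + u \<bullet> ((transpose K ** K) *v u) - \<epsilon> * ((norm x)\<^sup>2 + (norm u)\<^sup>2)"
    using scaled_storage_form[OF t pos, of "transpose K ** K" B] R unfolding pos_definite_def by blast
  obtain lam where rot: "\<And>x u. g (x, u) \<le> 0 \<Longrightarrow>
    lq_cost (transpose C ** C) (transpose K ** K) z v c (x\<^sub>e, u\<^sub>e) +
      (norm (C *v (x - x\<^sub>e)))\<^sup>2 + (u - u\<^sub>e) \<bullet> ((transpose K ** K) *v (u - u\<^sub>e)) + lam \<bullet> (x - (A *v x + B *v u))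
    \<le> lq_cost (transpose C ** C) (transpose K ** K) z v c (x, u)"
    using KKT_rotated_cost[OF KKT] by blast
  have steady: "A *v x\<^sub>e + B *v u\<^sub>e = x\<^sub>e" using KKT by (auto simp: KKT_def)
  define V where "V x = \<delta> * ((x - x\<^sub>e) \<bullet> (P *v (x - x\<^sub>e))) - lam \<bullet> x" for x
  have "bounded (V ` D)" if "bounded D" for D
  proof -
    have "compact (V ` closure D)"
      using that unfolding V_def
      by (intro compact_continuous_image continuous_intros) (simp_all add: compact_closure)
    then show ?thesis
      by (meson bounded_subset closure_subset compact_imp_bounded image_mono)
  qed
  moreover have "V (A *v x + B *v u) \<le> V x + lq_cost (transpose C ** C) (transpose K ** K) z v c (x, u)
      - lq_cost (transpose C ** C) (transpose K ** K) z v c (x\<^sub>e, u\<^sub>e) - \<epsilon> * (norm ((x, u) - (x\<^sub>e, u\<^sub>e)))\<^sup>2"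
    if "g (x, u) \<le> 0" for x u
  proof -
    \<comment> \<open>Displacements from a steady state evolve under the same linear dynamics, so
      \<open>form\<close> applies to them.\<close>
    have "A *v x + B *v u - x\<^sub>e = A *v (x - x\<^sub>e) + B *v (u - u\<^sub>e)"
      using steady by (simp add: matrix_vector_mult_diff_distrib algebra_simps)
    then show ?thesis
      using form[of "x - x\<^sub>e" "u - u\<^sub>e"] rot[OF that]
      by (simp add: V_def norm_Pair inner_diff_right)
  qed
  ultimately have "strict_storage (CLQ A B (transpose C ** C) (transpose K ** K) z v c g) (x\<^sub>e, u\<^sub>e) V"
    unfolding strict_storage_def CLQ_def
    by (auto intro!: exI[of _ norm] exI[of _ "\<lambda>r. \<epsilon> * r\<^sup>2"] simp: is_norm_norm scaled_square_in_class_K \<epsilon>)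
  with \<delta> show ?thesis using that unfolding V_def by blast
qed

text \<open>Completing the square with \<open>k = \<delta> * \<rho>\<close> shows that the linear
  term lowers the coercive form by at most \<open>(norm lam)\<^sup>2 / (4 * k)\<close>, up to the
  constant \<open>lam \<bullet> x\<^sub>e\<close>.\<close>

lemma coercive_quadratic_bdd_below:
  fixes P :: "real^'n^'n"
  assumes "0 < \<rho>" "\<And>x. \<rho> * (norm x)\<^sup>2 \<le> x \<bullet> (P *v x)" "0 < \<delta>"
  shows "bdd_below ((\<lambda>x. \<delta> * ((x - x\<^sub>e) \<bullet> (P *v (x - x\<^sub>e))) - lam \<bullet> x) ` X)"
proof (rule bdd_belowI2)
  fix x
  define d where "d = x - x\<^sub>e"
  define k where "k = \<delta> * \<rho>"
  have "0 < k" using assms by (simp add: k_def)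
  have "lam \<bullet> d \<le> norm lam * norm d" by (rule norm_cauchy_schwarz)
  also have "\<dots> \<le> k * (norm d)\<^sup>2 + (norm lam)\<^sup>2 / (4 * k)"
  proof -
    have "0 \<le> (2 * k * norm d - norm lam)\<^sup>2 / (4 * k)" using \<open>0 < k\<close> by simp
    also have "\<dots> = k * (norm d)\<^sup>2 + (norm lam)\<^sup>2 / (4 * k) - norm lam * norm d"
      using \<open>0 < k\<close> by (simp add: power2_eq_square field_simps)
    finally show ?thesis by simp
  qed
  also have "k * (norm d)\<^sup>2 \<le> \<delta> * (d \<bullet> (P *v d))"
    using assms(2)[of d] assms(3) by (simp add: k_def)
  finally show "- (norm lam)\<^sup>2 / (4 * k) - lam \<bullet> x\<^sub>e \<le> \<delta> * ((x - x\<^sub>e) \<bullet> (P *v (x - x\<^sub>e))) - lam \<bullet> x"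
    by (simp add: d_def inner_diff_right)
qed

theorem theorem7:
  fixes A :: "real^'n^'n" and B :: "real^'m^'n"
    and Q C :: "real^'n^'n" and R K :: "real^'m^'m"
    and z :: "real^'n" and v :: "real^'m" and c :: real
    and g :: "(real^'n) \<times> (real^'m) \<Rightarrow> real"
    and x\<^sub>e :: "real^'n" and u\<^sub>e :: "real^'m"
  assumes "pos_semidefinite Q" and "Q = transpose C ** C"
    and "pos_definite R" and "R = transpose K ** K" and "invertible K"
    and "convex_on UNIV g"
    and "frontier {w. g w \<le> 0} = {w. g w = 0}"
    and "optimal_steady_state (CLQ A B Q R z v c g) (x\<^sub>e, u\<^sub>e)"
    and "\<And>\<gamma>. unobservable_eigenvalue A C \<gamma> \<Longrightarrow> cmod \<gamma> \<noteq> 1"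
    and "KKT A B C K z v g (x\<^sub>e, u\<^sub>e)"
  shows "strictly_pre_dissipative (CLQ A B Q R z v c g) (x\<^sub>e, u\<^sub>e) \<and>
         (detectable A C \<longrightarrow> strictly_dissipative (CLQ A B Q R z v c g) (x\<^sub>e, u\<^sub>e))"
proof (intro conjI impI)
  have steady: "steady_state (CLQ A B Q R z v c g) (x\<^sub>e, u\<^sub>e)"
    using assms(8) by (simp add: optimal_steady_state_def is_arg_min_def)
  have R: "pos_definite (transpose K ** K)" using assms(3,4) by simp
  show "strictly_pre_dissipative (CLQ A B Q R z v c g) (x\<^sub>e, u\<^sub>e)"
  proof -
    \<comment> \<open>Here \<open>P\<close> may be indefinite: pre-dissipativity asks for
      boundedness on bounded sets only.\<close>
    obtain t P where "0 \<le> t"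
      "\<And>x. x \<noteq> 0 \<Longrightarrow> 0 < t * (norm (C *v x))\<^sup>2 + x \<bullet> (P *v x) - (A *v x) \<bullet> (P *v (A *v x))"
      using strict_stein_solution[OF assms(9)] by blast
    from quadratic_strict_storage[OF R assms(10) this] show ?thesis
      using steady unfolding strictly_pre_dissipative_def assms(2,4) by blast
  qed
  assume det: "detectable A C"
  show "strictly_dissipative (CLQ A B Q R z v c g) (x\<^sub>e, u\<^sub>e)"
  proof -
    \<comment> \<open>Detectability supplies a coercive \<open>P\<close>, which bounds the storage
      function below on any set of states.\<close>
    obtain t P \<rho> where P: "0 \<le> t" "0 < \<rho>" "\<And>x. \<rho> * (norm x)\<^sup>2 \<le> x \<bullet> (P *v x)"
      "\<And>x. x \<noteq> 0 \<Longrightarrow> 0 < t * (norm (C *v x))\<^sup>2 + x \<bullet> (P *v x) - (A *v x) \<bullet> (P *v (A *v x))"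
      by (rule detectable_coercive_stein_solution[OF det]) (rule that)
    obtain \<delta> lam where \<delta>: "0 < \<delta>" and V: "strict_storage (CLQ A B Q R z v c g) (x\<^sub>e, u\<^sub>e)
        (\<lambda>x. \<delta> * ((x - x\<^sub>e) \<bullet> (P *v (x - x\<^sub>e))) - lam \<bullet> x)"
      using quadratic_strict_storage[OF R assms(10) P(1,4)] unfolding assms(2,4) by blast
    show ?thesis
      unfolding strictly_dissipative_def
      by (rule conjI[OF steady], rule exI, rule conjI[OF V], rule coercive_quadratic_bdd_below[OF P(2,3) \<delta>])
  qed
qed

end
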